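(* Let $\mathcal{R}$ be a ring with unity, let $a,b,c\in\mathcal{R}$, and let $y\in\mathcal{R}$ be an outer inverse of $a$ (i.e. $yay=y$). Then the following statements are equivalent. (i) $y$ is the $(b,c)$-inverse of $a$. (ii) $\mathcal{R}y=\mathcal{R}c$, $y\mathcal{R}\subseteq b\mathcal{R}$ and $y_{-1}(0)\subseteq b_{-1}(0)$. (iii) $y\mathcal{R}=b\mathcal{R}$, $\mathcal{R}y\subseteq\mathcal{R}c$ and $y^{-1}(0)\subseteq c^{-1}(0)$. (iv) $\mathcal{R}y\subseteq\mathcal{R}c$, $y\mathcal{R}\subseteq b\mathcal{R}$, $y_{-1}(0)\subseteq b_{-1}(0)$ and $y^{-1}(0)\subseteq c^{-1}(0)$. In addition, if $b$ and $c$ are regular, then each of the following statements is equivalent to (i). (v) $\mathcal{R}y=\mathcal{R}c$, $b\mathcal{R}\subseteq y\mathcal{R}$ and $b_{-1}(0)\subseteq y_{-1}(0)$. (vi) $y\mathcal{R}=b\mathcal{R}$, $\mathcal{R}c\subseteq\mathcal{R}y$ and $c^{-1}(0)\subseteq y^{-1}(0)$. (vii) $\mathcal{R}y=\mathcal{R}c$ and $y_{-1}(0)=b_{-1}(0)$. (viii) $\mathcal{R}y\subseteq\mathcal{R}c$, $b\mathcal{R}\subseteq y\mathcal{R}$, $y^{-1}(0)\subseteq c^{-1}(0)$ and $b_{-1}(0)\subseteq y_{-1}(0)$. (ix) $\mathcal{R}c\subseteq\mathcal{R}y$, $y\mathcal{R}\subseteq b\mathcal{R}$, $y_{-1}(0)\subseteq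 b_{-1}(0)$ and $c^{-1}(0)\subseteq y^{-1}(0)$. (x) $\mathcal{R}c\subseteq\mathcal{R}y$, $b\mathcal{R}\subseteq y\mathcal{R}$, $c^{-1}(0)\subseteq y^{-1}(0)$ and $b_{-1}(0)\subseteq y_{-1}(0)$. (xi) $y\mathcal{R}=b\mathcal{R}$ and $y^{-1}(0)=c^{-1}(0)$. (xii) $\mathcal{R}y\subseteq\mathcal{R}c$, $y^{-1}(0)\subseteq c^{-1}(0)$ and $y_{-1}(0)=b_{-1}(0)$. (xiii) $\mathcal{R}c\subseteq\mathcal{R}y$, $c^{-1}(0)\subseteq y^{-1}(0)$ and $y_{-1}(0)=b_{-1}(0)$. (xiv) $b\mathcal{R}\subseteq y\mathcal{R}$, $b_{-1}(0)\subseteq y_{-1}(0)$ and $y^{-1}(0)=c^{-1}(0)$. (xv) $y\mathcal{R}\subseteq b\mathcal{R}$, $y_{-1}(0)\subseteq b_{-1}(0)$ and $y^{-1}(0)=c^{-1}(0)$. (xvi) $y^{-1}(0)=c^{-1}(0)$ and $y_{-1}(0)=b_{-1}(0)$.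
   Context: For $x$ in a ring $\mathcal{R}$ with unity: $x\mathcal{R}=\{xr: r\in\mathcal{R}\}$, $\mathcal{R}x=\{rx: r\in\mathcal{R}\}$, $x^{-1}(0)=\{r\in\mathcal{R}: xr=0\}$ and $x_{-1}(0)=\{r\in\mathcal{R}: rx=0\}$. An element $x$ is regular if there is $w\in\mathcal{R}$ with $x=xwx$. Given $b,c\in\mathcal{R}$, an element $y\in\mathcal{R}$ is the $(b,c)$-inverse of $a\in\mathcal{R}$ if $y\in(b\mathcal{R}y)\cap(y\mathcal{R}c)$, $b=yab$ and $c=cay$. Such a $y$ is unique if it exists, and it is an outer inverse of $a$. *)

theory Defs
  imports Main
begin

text \<open>
  The sort \<open>{ring, monoid_mult}\<close> is that of associative, not necessarily commutative rings with
  unity. Unlike \<open>ring_1\<close> it does not exclude the zero ring.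
\<close>

definition right_ideal :: "'a::{ring, monoid_mult} \<Rightarrow> 'a set" where
  "right_ideal x = {x * r | r. True}"

definition left_ideal :: "'a::{ring, monoid_mult} \<Rightarrow> 'a set" where
  "left_ideal x = {r * x | r. True}"

text \<open>\<open>right_ann x\<close> is written $x^{-1}(0)$ and \<open>left_ann x\<close> is written $x_{-1}(0)$.\<close>

definition right_ann :: "'a::{ring, monoid_mult} \<Rightarrow> 'a set" where
  "right_ann x = {r. x * r = 0}"

definition left_ann :: "'a::{ring, monoid_mult} \<Rightarrow> 'a set" where
  "left_ann x = {r. r * x = 0}"

definition regular_elem :: "'a::{ring, monoid_mult} \<Rightarrow> bool" where
  "regular_elem x \<longleftrightarrow> (\<exists>w. x = x * w * x)"

definition outer_inverse :: "'a::{ring, monoid_mult} \<Rightarrow> 'a \<Rightarrow> bool" where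
  "outer_inverse a y \<longleftrightarrow> y * a * y = y"

definition bc_inverse :: "'a::{ring, monoid_mult} \<Rightarrow> 'a \<Rightarrow> 'a \<Rightarrow> 'a \<Rightarrow> bool" where
  "bc_inverse b c a y \<longleftrightarrow>
     y \<in> {b * r * y | r. True} \<inter> {y * r * c | r. True} \<and> b = y * a * b \<and> c = c * a * y"

text \<open>Uniqueness justifies reading \<open>bc_inverse b c a y\<close> as ``\<open>y\<close> is \<^emph>\<open>the\<close> \<open>(b, c)\<close>-inverse of \<open>a\<close>''.\<close>

lemma bc_inverse_unique:
  assumes "bc_inverse b c a y" and "bc_inverse b c a z"
  shows "y = z"
proof -
  obtain r where r: "y = y * r * c" using assms(1) by (auto simp: bc_inverse_def)
  obtain s where s: "z = b * s * z" using assms(2) by (auto simp: bc_inverse_def)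
  have c: "c = c * a * z" and b: "b = y * a * b"
    using assms by (auto simp: bc_inverse_def)
  have "y = y * r * (c * a * z)" using r c by simp
  also have "\<dots> = y * r * c * a * z" by (simp add: mult.assoc)
  also have "\<dots> = y * a * z" using r by simp
  also have "\<dots> = y * a * (b * s * z)" using s by simp
  also have "\<dots> = y * a * b * s * z" by (simp add: mult.assoc)
  also have "\<dots> = z" using b s by simp
  finally show ?thesis .
qed

lemma bc_inverse_imp_outer_inverse:
  assumes "bc_inverse b c a y"
  shows "outer_inverse a y"
proof -
  obtain s where s: "y = b * s * y" using assms by (auto simp: bc_inverse_def)
  have b: "b = y * a * b" using assms by (auto simp: bc_inverse_def)
  have "y * a * y = y * a * (b * s * y)" using s by simp
  also have "\<dots> = y * a * b * s * y" by (simp add: mult.assoc)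
  also have "\<dots> = y" using b s by simp
  finally show ?thesis by (simp add: outer_inverse_def)
qed

end

theory Submission
  imports Defs
begin

text \<open>
  Given \<open>y * a * y = y\<close>, being the \<open>(b, c)\<close>-inverse of \<open>a\<close> just means that \<open>y\<close> generates the
  same right ideal as \<open>b\<close> and the same left ideal as \<open>c\<close>. An inclusion of principal right (left)
  ideals always reverses to an inclusion of left (right) annihilators, and this is an equivalence
  as soon as the generator of the larger ideal is regular. As \<open>y\<close> is itself regular, and \<open>b\<close>
  and \<open>c\<close> are so from (v) on, each condition rewrites to these two equalities of ideals.
\<close>

lemma right_ideal_subset_iff:
  "right_ideal x \<subseteq> right_ideal z \<longleftrightarrow> (\<exists>r. x = z * r)"
proof
  assume "right_ideal x \<subseteq> right_ideal z"
  moreover have "x * 1 \<in> right_ideal x"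
    unfolding right_ideal_def by blast
  ultimately show "\<exists>r. x = z * r"
    by (auto simp: right_ideal_def)
next
  assume "\<exists>r. x = z * r"
  then show "right_ideal x \<subseteq> right_ideal z"
    by (auto simp: right_ideal_def mult.assoc)
qed

lemma left_ideal_subset_iff:
  "left_ideal x \<subseteq> left_ideal z \<longleftrightarrow> (\<exists>r. x = r * z)"
proof
  assume "left_ideal x \<subseteq> left_ideal z"
  moreover have "1 * x \<in> left_ideal x"
    unfolding left_ideal_def by blast
  ultimately show "\<exists>r. x = r * z"
    by (auto simp: left_ideal_def)
next
  assume "\<exists>r. x = r * z"
  then show "left_ideal x \<subseteq> left_ideal z"
    by (auto simp: left_ideal_def mult.assoc [symmetric])
qed

text \<open>If \<open>z = z * w * z\<close>, then \<open>z * w\<close> is an idempotent fixing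
  \<open>z\<close> from the left, so its complement \<open>1 - z * w\<close> lies in
  \<open>left_ann z\<close>. Once that complement kills \<open>x\<close> as well,
  \<open>x = z * w * x\<close> is a right multiple of \<open>z\<close>.\<close>

lemma left_ann_subset_iff_right_ideal_subset:
  assumes "regular_elem z"
  shows "left_ann z \<subseteq> left_ann x \<longleftrightarrow> right_ideal x \<subseteq> right_ideal z"
proof
  assume sub: "left_ann z \<subseteq> left_ann x"
  obtain w where w: "z = z * w * z"
    using assms by (auto simp: regular_elem_def)
  have "1 - z * w \<in> left_ann z"
    using w by (simp add: left_ann_def left_diff_distrib)
  with sub have "(1 - z * w) * x = 0"
    by (auto simp: left_ann_def)
  then have "x = z * (w * x)"
    by (simp add: left_diff_distrib mult.assoc)
  then show "right_ideal x \<subseteq> right_ideal z"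
    by (auto simp only: right_ideal_subset_iff)
next
  assume "right_ideal x \<subseteq> right_ideal z"
  then obtain r where "x = z * r"
    by (auto simp: right_ideal_subset_iff)
  then show "left_ann z \<subseteq> left_ann x"
    by (auto simp: left_ann_def mult.assoc [symmetric])
qed

text \<open>Mirror image of the preceding argument, with the idempotent \<open>w * z\<close> acting
  from the right and its complement \<open>1 - w * z\<close> in \<open>right_ann z\<close>.\<close>

lemma right_ann_subset_iff_left_ideal_subset:
  assumes "regular_elem z"
  shows "right_ann z \<subseteq> right_ann x \<longleftrightarrow> left_ideal x \<subseteq> left_ideal z"
proof
  assume sub: "right_ann z \<subseteq> right_ann x"
  obtain w where w: "z = z * w * z"
    using assms by (auto simp: regular_elem_def)
  have "1 - w * z \<in> right_ann z"
    using w by (simp add: right_ann_def right_diff_distrib mult.assoc)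
  with sub have "x * (1 - w * z) = 0"
    by (auto simp: right_ann_def)
  then have "x = (x * w) * z"
    by (simp add: right_diff_distrib mult.assoc)
  then show "left_ideal x \<subseteq> left_ideal z"
    by (auto simp only: left_ideal_subset_iff)
next
  assume "left_ideal x \<subseteq> left_ideal z"
  then obtain r where "x = r * z"
    by (auto simp: left_ideal_subset_iff)
  then show "right_ann z \<subseteq> right_ann x"
    by (auto simp: right_ann_def mult.assoc)
qed

text \<open>The inner factor is \<open>a\<close> itself. This lets inclusions out of the
  annihilators of \<open>y\<close> be translated whatever \<open>b\<close> and \<open>c\<close>
  are.\<close>

lemma outer_inverse_imp_regular:
  "outer_inverse a y \<Longrightarrow> regular_elem y"
  unfolding outer_inverse_def regular_elem_def by metis

text \<open>By \<open>y * a * y = y\<close>, the element \<open>y * a\<close> is a left identity on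
  \<open>right_ideal y\<close> and \<open>a * y\<close> a right identity on
  \<open>left_ideal y\<close>. Hence \<open>b\<close> and \<open>c\<close> are fixed by them as soon
  as they lie in these ideals.\<close>

lemma bc_inverse_iff_ideals:
  assumes "outer_inverse a y"
  shows "bc_inverse b c a y \<longleftrightarrow> right_ideal y = right_ideal b \<and> left_ideal y = left_ideal c"
proof
  assume "bc_inverse b c a y"
  then obtain r s where y: "y = b * r * y" "y = y * s * c"
    and b: "b = y * a * b" and c: "c = c * a * y"
    unfolding bc_inverse_def by blast
  have "y = b * (r * y)" "b = y * (a * b)"
    using y(1) b by (simp_all only: mult.assoc)
  then show "right_ideal y = right_ideal b \<and> left_ideal y = left_ideal c"
    unfolding set_eq_subset right_ideal_subset_iff left_ideal_subset_iff
    using y(2) c by blast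
next
  assume "right_ideal y = right_ideal b \<and> left_ideal y = left_ideal c"
  then obtain r s u v where y: "y = b * r" "y = s * c" and b: "b = y * u" and c: "c = v * y"
    unfolding set_eq_subset right_ideal_subset_iff left_ideal_subset_iff by blast
  have yay: "y * a * y = y"
    using assms by (simp add: outer_inverse_def)
  \<comment> \<open>The witnesses \<open>r * a\<close> and \<open>a * s\<close> come from
    \<open>y = y * a * y\<close> by writing its first \<open>y\<close> as \<open>b * r\<close>,
    respectively its last \<open>y\<close> as \<open>s * c\<close>.\<close>
  have "b * (r * a) * y = b * r * a * y" "y * (a * s) * c = y * a * (s * c)"
    by (simp_all only: mult.assoc)
  then have "y = b * (r * a) * y" "y = y * (a * s) * c"
    by (simp_all only: y [symmetric] yay)
  moreover have "y * a * b = y * a * y * u" "c * a * y = v * (y * a * y)"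
    unfolding b c by (simp_all only: mult.assoc)
  then have "b = y * a * b" "c = c * a * y"
    by (simp_all only: yay b [symmetric] c [symmetric])
  ultimately show "bc_inverse b c a y"
    unfolding bc_inverse_def by blast
qed

theorem theorem3p1:
  fixes a b c y :: "'a::{ring, monoid_mult}"
  assumes "outer_inverse a y"
  shows
    "(bc_inverse b c a y \<longleftrightarrow>
        left_ideal y = left_ideal c \<and> right_ideal y \<subseteq> right_ideal b \<and> left_ann y \<subseteq> left_ann b) \<and>
     (bc_inverse b c a y \<longleftrightarrow>
        right_ideal y = right_ideal b \<and> left_ideal y \<subseteq> left_ideal c \<and> right_ann y \<subseteq> right_ann c) \<and>
     (bc_inverse b c a y \<longleftrightarrow>
        left_ideal y \<subseteq> left_ideal c \<and> right_ideal y \<subseteq> right_ideal b \<and>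
        left_ann y \<subseteq> left_ann b \<and> right_ann y \<subseteq> right_ann c) \<and>
     (regular_elem b \<and> regular_elem c \<longrightarrow>
       (bc_inverse b c a y \<longleftrightarrow>
          left_ideal y = left_ideal c \<and> right_ideal b \<subseteq> right_ideal y \<and> left_ann b \<subseteq> left_ann y) \<and>
       (bc_inverse b c a y \<longleftrightarrow>
          right_ideal y = right_ideal b \<and> left_ideal c \<subseteq> left_ideal y \<and> right_ann c \<subseteq> right_ann y) \<and>
       (bc_inverse b c a y \<longleftrightarrow>
          left_ideal y = left_ideal c \<and> left_ann y = left_ann b) \<and>
       (bc_inverse b c a y \<longleftrightarrow>
          left_ideal y \<subseteq> left_ideal c \<and> right_ideal b \<subseteq> right_ideal y \<and>
          right_ann y \<subseteq> right_ann c \<and> left_ann b \<subseteq> left_ann y) \<and>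
       (bc_inverse b c a y \<longleftrightarrow>
          left_ideal c \<subseteq> left_ideal y \<and> right_ideal y \<subseteq> right_ideal b \<and>
          left_ann y \<subseteq> left_ann b \<and> right_ann c \<subseteq> right_ann y) \<and>
       (bc_inverse b c a y \<longleftrightarrow>
          left_ideal c \<subseteq> left_ideal y \<and> right_ideal b \<subseteq> right_ideal y \<and>
          right_ann c \<subseteq> right_ann y \<and> left_ann b \<subseteq> left_ann y) \<and>
       (bc_inverse b c a y \<longleftrightarrow>
          right_ideal y = right_ideal b \<and> right_ann y = right_ann c) \<and>
       (bc_inverse b c a y \<longleftrightarrow>
          left_ideal y \<subseteq> left_ideal c \<and> right_ann y \<subseteq> right_ann c \<and> left_ann y = left_ann b) \<and>
       (bc_inverse b c a y \<longleftrightarrow>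
          left_ideal c \<subseteq> left_ideal y \<and> right_ann c \<subseteq> right_ann y \<and> left_ann y = left_ann b) \<and>
       (bc_inverse b c a y \<longleftrightarrow>
          right_ideal b \<subseteq> right_ideal y \<and> left_ann b \<subseteq> left_ann y \<and> right_ann y = right_ann c) \<and>
       (bc_inverse b c a y \<longleftrightarrow>
          right_ideal y \<subseteq> right_ideal b \<and> left_ann y \<subseteq> left_ann b \<and> right_ann y = right_ann c) \<and>
       (bc_inverse b c a y \<longleftrightarrow>
          right_ann y = right_ann c \<and> left_ann y = left_ann b))"
proof -
  note y_regular = outer_inverse_imp_regular [OF assms]
  note iffs = bc_inverse_iff_ideals [OF assms] set_eq_subset
    left_ann_subset_iff_right_ideal_subset [OF y_regular]
    right_ann_subset_iff_left_ideal_subset [OF y_regular]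
  show ?thesis
  \<comment> \<open>With \<open>b\<close> and \<open>c\<close> regular, every condition becomes a
    propositional combination of four inclusions: those between the right ideals of \<open>y\<close>
    and \<open>b\<close>, and those between the left ideals of \<open>y\<close> and
    \<open>c\<close>.\<close>
  proof (cases "regular_elem b \<and> regular_elem c")
    case True
    then have regular: "regular_elem b" "regular_elem c"
      by simp_all
    show ?thesis
      unfolding iffs left_ann_subset_iff_right_ideal_subset [OF regular(1)]
        right_ann_subset_iff_left_ideal_subset [OF regular(2)]
      by (intro conjI impI; satx)
  next
    case False
    \<comment> \<open>The first three equivalences contain only inclusions out of the annihilators
      of \<open>y\<close>, which \<open>iffs\<close> translates; the remaining ones stand under a
      premise that is false here.\<close>
    then show ?thesis
      unfolding iffs by (intro conjI impI; satx)
  qed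
qed

end
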